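(* Let $\alpha>1$. Let $(\mathcal Q,d)$ be a separable and complete metric space and let $o\in\mathcal Q$ be an arbitrary fixed element. Let $Y$ be a random variable with values in $\mathcal Q$, and let $Y_1,Y_2,\dots$ be independent random variables with the same distribution as $Y$. Let $(\epsilon_n)_{n\in\mathbb N}\subseteq[0,\infty)$ with $\epsilon_n\to0$ as $n\to\infty$. Set $$M=\operatorname*{arg\,min}_{q\in\mathcal Q}\mathbb E[d(Y,q)^\alpha-d(Y,o)^\alpha],\qquad M_n=\epsilon_n\text{-}\operatorname*{arg\,min}_{q\in\mathcal Q}\frac1n\sum_{i=1}^n\bigl(d(Y_i,q)^\alpha-d(Y_i,o)^\alpha\bigr).$$ Assume $\mathbb E[d(Y,o)^{\alpha-1}]<\infty$. (i) Then $\operatorname*{lim\,\overline{sup}}_{n\to\infty}M_n\subseteq M$ almost surely. (ii) Additionally, assume that almost surely the following is true: there is $N_0\in\mathbb N$ such that every closed and bounded subset (closed in $\mathcal Q$) of $\bigcup_{n\ge N_0}M_n$ is compact. Then $d_\subseteq(M_n,M)\to0$ almost surely as $n\to\infty$.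
   Context: All random variables are defined on a common probability space $(\Omega,\Sigma,\mathbb P)$; $\mathcal Q$ carries its Borel $\sigma$-algebra. For $f\colon\mathcal Q\to\mathbb R$ and $\epsilon\ge0$: $\operatorname{arg\,min} f=\{q\in\mathcal Q: f(q)=\inf_{\mathcal Q} f\}$ and $\epsilon\text{-}\operatorname{arg\,min} f=\{q\in\mathcal Q: f(q)\le\epsilon+\inf_{\mathcal Q} f\}$ (empty if $\inf_{\mathcal Q} f=-\infty$). The outer limit of a sequence of sets $B_n\subseteq\mathcal Q$ is $\operatorname*{lim\,\overline{sup}}_{n\to\infty}B_n:=\bigcap_{n\in\mathbb N}\overline{\bigcup_{k\ge n}B_k}$, where the bar denotes topological closure in $\mathcal Q$. The one-sided Hausdorff distance between $B,B'\subseteq\mathcal Q$ is $d_\subseteq(B,B'):=\sup_{x\in B}\inf_{x'\in B'}d(x,x')\in[0,\infty]$, with $\sup\emptyset=0$ and $\inf\emptyset=\infty$. "Almost surely" means outside a set contained in a $\mathbb P$-null set. *)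

theory Defs
  imports "HOL-Probability.Probability"
begin

text \<open>Infima are taken in the extended reals: for a function that is unbounded below both sets
  are empty, whereas the infimum in type \<^typ>\<open>real\<close> would be an unspecified real number.\<close>

definition argmin_set :: "('a \<Rightarrow> real) \<Rightarrow> 'a set" where
  "argmin_set f = {q. ereal (f q) = (INF x. ereal (f x))}"

definition eps_argmin_set :: "real \<Rightarrow> ('a \<Rightarrow> real) \<Rightarrow> 'a set" where
  "eps_argmin_set \<epsilon> f = {q. ereal (f q) \<le> ereal \<epsilon> + (INF x. ereal (f x))}"

text \<open>Sequences are indexed from 1 on; their values at index 0 play no role.\<close>

definition outer_limit :: "(nat \<Rightarrow> 'a::topological_space set) \<Rightarrow> 'a set" where
  "outer_limit B = (\<Inter>n\<in>{1..}. closure (\<Union>k\<in>{n..}. B k))"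

text \<open>In \<^typ>\<open>ennreal\<close> the supremum of the empty set is 0 and its infimum is \<open>\<infinity>\<close>.
  (The library's \<^const>\<open>infdist\<close> is not used since it is 0 for the empty set.)\<close>

definition one_sided_hausdorff_dist :: "'a::metric_space set \<Rightarrow> 'a set \<Rightarrow> ennreal" where
  "one_sided_hausdorff_dist B B' = (SUP x\<in>B. INF x'\<in>B'. ennreal (dist x x'))"

definition frechet_mean_set ::
    "real \<Rightarrow> 'w measure \<Rightarrow> ('w \<Rightarrow> 'q) \<Rightarrow> 'q::metric_space \<Rightarrow> 'q set" where
  "frechet_mean_set \<alpha> P Y q0 =
     argmin_set (\<lambda>q. \<integral>\<omega>. (dist (Y \<omega>) q powr \<alpha> - dist (Y \<omega>) q0 powr \<alpha>) \<partial>P)"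

definition empirical_frechet_mean_set ::
    "real \<Rightarrow> (nat \<Rightarrow> real) \<Rightarrow> (nat \<Rightarrow> 'w \<Rightarrow> 'q) \<Rightarrow> 'q::metric_space \<Rightarrow> nat \<Rightarrow> 'w \<Rightarrow> 'q set" where
  "empirical_frechet_mean_set \<alpha> \<epsilon> Ys q0 n \<omega> =
     eps_argmin_set (\<epsilon> n)
       (\<lambda>q. 1 / real n * (\<Sum>i=1..n. dist (Ys i \<omega>) q powr \<alpha> - dist (Ys i \<omega>) q0 powr \<alpha>))"

end

theory Submission
  imports Defs
begin

text \<open>
  Write \<open>F q\<close> for the expected and \<open>F\<^sub>n q\<close> for the empirical mean of
  \<open>d(Y, q)\<^sup>\<alpha> - d(Y, q0)\<^sup>\<alpha>\<close>, and let \<open>m\<^sub>n\<close> be the empirical mean of \<open>d(Y, q0)\<close> to the power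
  \<open>\<alpha> - 1\<close>. Subtracting \<open>d(Y, q0)\<^sup>\<alpha>\<close> is what makes a moment of order \<open>\<alpha> - 1\<close> sufficient: by the
  mean value theorem, \<open>q \<mapsto> d(y, q)\<^sup>\<alpha>\<close> is Lipschitz on each ball around \<open>q0\<close>, with a constant that
  grows only like \<open>d(y, q0)\<close> to the power \<open>\<alpha> - 1\<close> (\<open>dist_powr_diff_bound\<close>).

  The strong law of large numbers gives, outside one null set, the convergence of \<open>m\<^sub>n\<close> and of
  \<open>F\<^sub>n p\<close> for all \<open>p\<close> in a countable dense set. From here on the sample is fixed and the argument
  is deterministic.

  \<^item> As \<open>m\<^sub>n\<close> is bounded, the \<open>F\<^sub>n\<close> are uniformly Lipschitz on balls, so pointwise convergence on the
    dense set becomes continuous convergence: \<open>x\<^sub>n \<longlonglongrightarrow> x\<close> implies \<open>F\<^sub>n x\<^sub>n \<longlonglongrightarrow> F x\<close>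
    (\<open>empirical_objective_continuous_convergence\<close>). The inequality
    \<open>F\<^sub>n x\<^sub>n \<le> \<epsilon>\<^sub>n + F\<^sub>n p\<close> that defines approximate minimizers therefore passes to the limit along
    subsequences, and every point of the outer limit minimizes \<open>F\<close>.
  \<^item> The objectives are uniformly coercive: for \<open>r = d(q, q0)\<close> one has
    \<open>F\<^sub>n q \<ge> c r\<^sup>\<alpha> - C r m\<^sub>n\<close> with \<open>c > 0\<close> (\<open>powr_coercive\<close>), while
    \<open>F\<^sub>n q \<le> \<epsilon>\<^sub>n\<close> for approximate minimizers, because \<open>F\<^sub>n q0 = 0\<close>. Hence from some index on all
    approximate minimizers lie in one ball.
  \<^item> If approximate minimizers \<open>x\<^sub>n\<close> stayed away from the minimizers along a subsequence, they would
    form a bounded sequence. Without a convergent subsequence its range would be closed, hence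
    compact by the hypothesis of the second part; so a subsequence converges, and its limit lies in
    the outer limit, thus among the minimizers, a contradiction
    (\<open>one_sided_hausdorff_dist_tendsto_0\<close>).

  The strong law itself is proved after Etemadi. For nonnegative summands it suffices, by
  monotonicity of the partial sums, to treat the indices near \<open>a\<^sup>m\<close> for each \<open>a > 1\<close>. In the \<open>m\<close>-th
  sum all summands are truncated at \<open>a\<^sup>m\<close>; the resulting variances and the probabilities that the
  truncation changes anything are then summable in \<open>m\<close>, by the two geometric sums
  \<open>geometric_sum_above\<close> and \<open>geometric_sum_below\<close>.
\<close>

section \<open>Geometric subsequences\<close>

text \<open>The last nonzero term is less than \<open>x\<close> and dominates the sum. With \<open>X\<close> in place of \<open>x\<close> the
  expectation of the left-hand side is \<open>\<Sum>n<N. a\<^sup>n P(X > a\<^sup>n)\<close>.\<close>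

lemma geometric_sum_below:
  fixes a x :: real
  assumes "a > 1" "x \<ge> 0"
  shows "(\<Sum>n<N. if a ^ n < x then a ^ n else 0) \<le> a / (a - 1) * x"
proof -
  have "(\<Sum>n<N. if a ^ n < x then a ^ n else 0) \<le> a / (a - 1) * x \<and>
        (\<Sum>n<N. if a ^ n < x then a ^ n else 0) \<le> (a ^ N - 1) / (a - 1)"
  proof (induction N)
    case 0
    then show ?case using assms by simp
  next
    case (Suc N)
    have step: "(a ^ N - 1) / (a - 1) + a ^ N = (a ^ Suc N - 1) / (a - 1)"
      using assms by (simp add: field_simps)
    show ?case
    proof (cases "a ^ N < x")
      case True
      have "(a ^ Suc N - 1) / (a - 1) \<le> a * x / (a - 1)"
        using True assms by (intro divide_right_mono) (auto intro: order_trans[of _ "a * a ^ N"])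
      then show ?thesis using True Suc step by auto
    next
      case False
      have "(a ^ N - 1) / (a - 1) \<le> (a ^ Suc N - 1) / (a - 1)"
        using assms by (intro divide_right_mono) (auto intro: order_trans[of _ "1 * a ^ N"])
      then show ?thesis using False Suc by auto
    qed
  qed
  then show ?thesis by blast
qed

text \<open>Here the first nonzero term dominates. With \<open>X\<close> in place of \<open>x\<close>, the expectation of the
  \<open>n\<close>-th term is, up to a factor \<open>a\<^sup>n\<close>, the second moment of \<open>X\<close> truncated at \<open>a\<^sup>n\<close>.\<close>

lemma geometric_sum_above:
  fixes a x :: real
  assumes "a > 1" "x \<ge> 0"
  shows "(\<Sum>n<N. if x \<le> a ^ n then x\<^sup>2 / a ^ n else 0) \<le> a / (a - 1) * x"
proof (cases "x = 0")
  case False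
  then have x: "x > 0" using assms by simp
  \<comment> \<open>The bound without \<open>1 / a ^ N\<close> is not inductive; the correction is the tail of the series.\<close>
  have "(\<Sum>n<N. if x \<le> a ^ n then 1 / a ^ n else 0) \<le>
     (if x \<le> a ^ N then a / (a - 1) * (1 / x - 1 / a ^ N) else 0)"
  proof (induction N)
    case 0
    have "x \<le> 1 \<Longrightarrow> 1 \<le> 1 / x" using x by simp
    then show ?case using assms by simp
  next
    case (Suc N)
    have mono: "a ^ N \<le> a ^ Suc N" using assms by simp
    have pos: "a ^ N > 0" using assms by simp
    have step: "a / (a - 1) * (1 / x - 1 / a ^ N) + 1 / a ^ N = a / (a - 1) * (1 / x - 1 / a ^ Suc N)"
      using assms x pos by (simp add: field_simps)
    consider "x \<le> a ^ N" | "\<not> x \<le> a ^ N" "x \<le> a ^ Suc N" | "\<not> x \<le> a ^ Suc N" by blast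
    then show ?case
    proof cases
      case 1
      then have "x \<le> a ^ Suc N" using mono by linarith
      then show ?thesis using 1 Suc step by auto
    next
      case 2
      have "1 / a ^ Suc N \<le> 1 / x" using 2 x by (intro divide_left_mono) auto
      then have "0 \<le> a / (a - 1) * (1 / x - 1 / a ^ Suc N)" using assms by simp
      then show ?thesis using 2 Suc by auto
    next
      case 3
      then have "\<not> x \<le> a ^ N" using mono by linarith
      then show ?thesis using 3 Suc by auto
    qed
  qed
  also have "\<dots> \<le> a / (a - 1) * (1 / x)"
  proof -
    have "a / (a - 1) * (1 / x - 1 / a ^ N) \<le> a / (a - 1) * (1 / x)"
      using assms by (intro mult_left_mono) auto
    then show ?thesis using assms x by auto
  qed
  finally have "x\<^sup>2 * (\<Sum>n<N. if x \<le> a ^ n then 1 / a ^ n else 0) \<le> x\<^sup>2 * (a / (a - 1) * (1 / x))"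
    by (intro mult_left_mono) auto
  then show ?thesis
    using x by (simp add: sum_distrib_left power2_eq_square if_distrib mult.commute cong: if_cong)
qed (simp cong: if_cong)

text \<open>For \<open>a\<^sup>m \<le> n < a\<^sup>m\<^sup>+\<^sup>1\<close>, monotonicity gives
  \<open>s(a\<^sup>m) / a\<^sup>m\<^sup>+\<^sup>1 \<le> s(n) / n \<le> s(a\<^sup>m\<^sup>+\<^sup>1) / a\<^sup>m\<close>. So the accumulation points of \<open>s(n) / n\<close> lie between
  \<open>\<mu> / a\<close> and \<open>a \<mu>\<close>, and \<open>a\<close> may be taken arbitrarily close to 1. Countably many \<open>a\<close> are used
  so that the hypothesis can hold almost surely for all of them at once.\<close>

lemma tendsto_mean_of_geometric_subsequences:
  fixes s :: "nat \<Rightarrow> real"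
  assumes mono: "mono s" and nonneg: "\<And>n. s n \<ge> 0"
    and lim: "\<And>j::nat. (\<lambda>m. s (nat \<lfloor>(1 + 1 / real (Suc j)) ^ m\<rfloor>) / (1 + 1 / real (Suc j)) ^ m) \<longlonglongrightarrow> \<mu>"
  shows "(\<lambda>n. s n / real n) \<longlonglongrightarrow> \<mu>"
proof -
  have bounds: "eventually (\<lambda>n. s n / n < a * \<mu> + a * e \<and> s n / n > \<mu> / a - e) sequentially"
    if a: "a = 1 + 1 / real (Suc j)" and e: "e > 0" for a e j
  proof -
    let ?V = "\<lambda>m. s (nat \<lfloor>a ^ m\<rfloor>) / a ^ m"
    have a1: "a > 1" using a by simp
    have V: "?V \<longlonglongrightarrow> \<mu>" using lim[of j] unfolding a .
    obtain m0 where m0: "\<And>m. m \<ge> m0 \<Longrightarrow> \<bar>?V m - \<mu>\<bar> < e"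
      using LIMSEQ_D[OF V e] by auto
    show ?thesis
    proof (rule eventually_sequentiallyI[of "nat \<lceil>a ^ m0\<rceil> + 1"])
      fix n :: nat
      assume n: "n \<ge> nat \<lceil>a ^ m0\<rceil> + 1"
      then have n1: "real n > a ^ m0" "n \<ge> 1" by linarith+
      define m where "m = nat \<lfloor>log a n\<rfloor>"
      have log0: "log a n \<ge> 0" using a1 n1 by simp
      have m_le: "real m \<le> log a n" "log a n < real m + 1" using log0 unfolding m_def by linarith+
      have am: "a ^ m \<le> n"
        using m_le(1) a1 n1 by (simp add: le_log_iff powr_realpow)
      have am1: "n < a ^ Suc m"
      proof -
        have "log a n < real (Suc m)" using m_le by simp
        then have "n < a powr real (Suc m)" using a1 n1 by (subst (asm) log_less_iff) auto
        then show ?thesis using a1 by (simp only: powr_realpow)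
      qed
      have mm: "m \<ge> m0"
      proof (rule ccontr)
        assume "\<not> m \<ge> m0"
        then have "a ^ Suc m \<le> a ^ m0" using a1 by (intro power_increasing) auto
        then show False using am1 n1 by simp
      qed
      have pos: "a ^ m > 0" using a1 by simp
      have np: "real n > 0" using n1 by simp
      have "s n \<le> s (nat \<lfloor>a ^ Suc m\<rfloor>)" using am1 by (intro monoD[OF mono]) linarith
      then have "s n / n \<le> s (nat \<lfloor>a ^ Suc m\<rfloor>) / a ^ m"
        using am pos np nonneg by (intro frac_le) auto
      also have "\<dots> = a * ?V (Suc m)" using a1 by simp
      also have "\<dots> < a * (\<mu> + e)" using a1 m0[of "Suc m"] mm by (intro mult_strict_left_mono) auto
      finally have u: "s n / n < a * \<mu> + a * e" by (simp add: algebra_simps)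
      have "\<mu> / a - e < ?V m / a"
      proof -
        have "e \<ge> e / a" using a1 e by (simp add: field_simps)
        moreover have "(\<mu> - e) / a < ?V m / a" using a1 m0[OF mm] by (intro divide_strict_right_mono) auto
        ultimately show ?thesis by (simp add: diff_divide_distrib)
      qed
      also have "?V m / a = s (nat \<lfloor>a ^ m\<rfloor>) / a ^ Suc m" by (simp add: mult.commute)
      also have "\<dots> \<le> s n / n"
      proof (rule frac_le)
        show "s (nat \<lfloor>a ^ m\<rfloor>) \<le> s n" using am by (intro monoD[OF mono]) linarith
      qed (use am1 nonneg np in auto)
      finally show "s n / n < a * \<mu> + a * e \<and> s n / n > \<mu> / a - e" using u by blast
    qed
  qed
  let ?a = "\<lambda>j. 1 + 1 / real (Suc j)"
  have a1: "?a \<longlonglongrightarrow> 1"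
    using tendsto_add[OF tendsto_const[of 1] LIMSEQ_inverse_real_of_nat] by (simp add: inverse_eq_divide)
  show ?thesis
  proof (rule order_tendstoI)
    fix y assume y: "y < \<mu>"
    have "(\<lambda>j. \<mu> / ?a j - 1 / real (Suc j)) \<longlonglongrightarrow> \<mu> / 1 - 0"
      using a1 LIMSEQ_inverse_real_of_nat by (intro tendsto_intros) (auto simp: inverse_eq_divide)
    then have "eventually (\<lambda>j. y < \<mu> / ?a j - 1 / real (Suc j)) sequentially"
      using y by (auto dest: order_tendstoD)
    then obtain j where "y < \<mu> / ?a j - 1 / real (Suc j)" by (auto simp: eventually_sequentially)
    then show "eventually (\<lambda>n. y < s n / n) sequentially"
      using bounds[OF refl, of "1 / real (Suc j)" j] by (auto elim!: eventually_mono)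
  next
    fix y assume y: "y > \<mu>"
    have "(\<lambda>j. ?a j * \<mu> + ?a j * (1 / real (Suc j))) \<longlonglongrightarrow> 1 * \<mu> + 1 * 0"
      using a1 LIMSEQ_inverse_real_of_nat by (intro tendsto_intros) (auto simp: inverse_eq_divide)
    then have "eventually (\<lambda>j. ?a j * \<mu> + ?a j * (1 / real (Suc j)) < y) sequentially"
      using y by (intro order_tendstoD) auto
    then obtain j where "?a j * \<mu> + ?a j * (1 / real (Suc j)) < y" by (auto simp: eventually_sequentially)
    then show "eventually (\<lambda>n. s n / n < y) sequentially"
      using bounds[OF refl, of "1 / real (Suc j)" j] by (auto elim!: eventually_mono)
  qed
qed

section \<open>The strong law of large numbers\<close>

text \<open>Bienayme's identity: the mixed terms vanish because each summand is independent of the sum of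
  the others.\<close>

lemma (in prob_space) expectation_square_sum_centered:
  fixes W :: "'i \<Rightarrow> 'a \<Rightarrow> real"
  assumes "finite I" "indep_vars (\<lambda>_. borel) W I"
    and "\<And>i. i \<in> I \<Longrightarrow> integrable M (W i)"
    and "\<And>i. i \<in> I \<Longrightarrow> integrable M (\<lambda>x. (W i x)\<^sup>2)"
    and "\<And>i. i \<in> I \<Longrightarrow> expectation (W i) = 0"
  shows "integrable M (\<lambda>x. (\<Sum>i\<in>I. W i x)\<^sup>2) \<and>
    expectation (\<lambda>x. (\<Sum>i\<in>I. W i x)\<^sup>2) = (\<Sum>i\<in>I. expectation (\<lambda>x. (W i x)\<^sup>2))"
  using assms
proof (induction I)
  case (insert i I)
  let ?S = "\<lambda>x. \<Sum>j\<in>I. W j x"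
  have IH: "integrable M (\<lambda>x. (?S x)\<^sup>2)"
    "expectation (\<lambda>x. (?S x)\<^sup>2) = (\<Sum>i\<in>I. expectation (\<lambda>x. (W i x)\<^sup>2))"
    using insert.IH insert.prems indep_vars_subset[OF insert.prems(1)] by auto
  have ind: "indep_var borel (W i) borel ?S"
    using insert by (intro indep_vars_sum) auto
  have S: "integrable M ?S" using insert.prems by (intro Bochner_Integration.integrable_sum) auto
  have prod: "integrable M (\<lambda>x. W i x * ?S x)" "expectation (\<lambda>x. W i x * ?S x) = 0"
    using indep_var_integrable[OF ind _ S] indep_var_lebesgue_integral[OF ind _ S] insert.prems by auto
  have eq: "(\<lambda>x. (\<Sum>j\<in>insert i I. W j x)\<^sup>2) = (\<lambda>x. (W i x)\<^sup>2 + 2 * (W i x * ?S x) + (?S x)\<^sup>2)"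
    using insert.hyps by (auto simp: power2_eq_square algebra_simps)
  show ?case
    unfolding eq using prod IH insert.prems insert.hyps by simp
qed simp

text \<open>The series of the \<open>U n\<close> has finite expectation, so it converges almost surely.\<close>

lemma (in prob_space) AE_tendsto_0_of_bounded_sum:
  fixes U :: "nat \<Rightarrow> 'a \<Rightarrow> real"
  assumes "\<And>n. integrable M (U n)" "\<And>n x. U n x \<ge> 0"
    and bound: "\<And>N. (\<Sum>n<N. expectation (U n)) \<le> C"
  shows "AE x in M. (\<lambda>n. U n x) \<longlonglongrightarrow> 0"
proof -
  have sm: "summable (\<lambda>n. expectation (U n))"
    using assms(2) bound by (intro summableI_nonneg_bounded[where x = C] Bochner_Integration.integral_nonneg)
  have [measurable]: "\<And>n. U n \<in> borel_measurable M" using assms by auto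
  have "(\<integral>\<^sup>+x. (\<Sum>n. ennreal (U n x)) \<partial>M) = (\<Sum>n. \<integral>\<^sup>+x. ennreal (U n x) \<partial>M)"
    by (intro nn_integral_suminf) simp
  also have "\<dots> = (\<Sum>n. ennreal (expectation (U n)))"
    using assms by (intro suminf_cong nn_integral_eq_integral) auto
  also have "\<dots> = ennreal (\<Sum>n. expectation (U n))"
    using assms(2) by (intro suminf_ennreal2 sm Bochner_Integration.integral_nonneg)
  finally have fin: "(\<integral>\<^sup>+x. (\<Sum>n. ennreal (U n x)) \<partial>M) < \<infinity>"
    by simp
  have "AE x in M. (\<Sum>n. ennreal (U n x)) \<noteq> \<infinity>"
    by (intro nn_integral_PInf_AE) (use fin in auto)
  then show ?thesis
  proof eventually_elim
    case (elim x)
    then have "summable (\<lambda>n. U n x)"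
      using assms(2) by (intro summable_suminf_not_top) auto
    then show ?case by (rule summable_LIMSEQ_zero)
  qed
qed

context prob_space
begin

lemma expectation_eq_of_distr_eq:
  fixes g :: "'b::topological_space \<Rightarrow> real"
  assumes "X \<in> borel_measurable M" "Z \<in> borel_measurable M" "distr M borel X = distr M borel Z"
    and "g \<in> borel_measurable borel"
  shows "expectation (\<lambda>x. g (X x)) = expectation (\<lambda>x. g (Z x))"
proof -
  have "expectation (\<lambda>x. g (X x)) = integral\<^sup>L (distr M borel X) g"
    by (rule integral_distr[symmetric]) (use assms in auto)
  also have "\<dots> = expectation (\<lambda>x. g (Z x))"
    unfolding assms(3) by (rule integral_distr) (use assms in auto)
  finally show ?thesis .
qed

lemma distr_compose_eq:
  fixes X Z :: "'a \<Rightarrow> 'b::topological_space" and g :: "'b \<Rightarrow> 'c::topological_space"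
  assumes "X \<in> borel_measurable M" "Z \<in> borel_measurable M" "distr M borel X = distr M borel Z"
    and "g \<in> borel_measurable borel"
  shows "distr M borel (\<lambda>x. g (X x)) = distr M borel (\<lambda>x. g (Z x))"
proof -
  have "distr M borel (\<lambda>x. f (X x)) = distr (distr M borel X) borel f"
    if "X \<in> borel_measurable M" "f \<in> borel_measurable borel" for X :: "'a \<Rightarrow> 'b" and f :: "'b \<Rightarrow> 'c"
    using distr_distr[OF that(2,1)] by (simp add: comp_def)
  from this[of X g] this[of Z g] show ?thesis using assms by simp
qed

text \<open>Truncating all summands of the \<open>m\<close>-th sum at the common level \<open>a\<^sup>m\<close>, which bounds the number
  of summands, costs only one geometric sum for the variances and one for the truncation error.\<close>

lemma slln_geometric_subsequence:
  fixes X :: "nat \<Rightarrow> 'a \<Rightarrow> real"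
  assumes indep: "indep_vars (\<lambda>_. borel) X {1..}"
    and X0: "integrable M X0" "\<And>x. X0 x \<ge> 0"
    and nonneg: "\<And>i x. X i x \<ge> 0"
    and dist: "\<And>i. i \<ge> 1 \<Longrightarrow> distr M borel (X i) = distr M borel X0"
    and a: "a > 1"
  shows "AE x in M. (\<lambda>m. (\<Sum>i=1..nat \<lfloor>a ^ m\<rfloor>. X i x) / a ^ m) \<longlonglongrightarrow> expectation X0"
proof -
  let ?C = "a / (a - 1)"
  define k where "k n = nat \<lfloor>a ^ n\<rfloor>" for n
  have apos: "a ^ n > 0" for n using a by simp
  have k: "real (k n) \<le> a ^ n" for n using apos[of n] unfolding k_def by linarith
  define T where "T n y = (if y \<le> a ^ n then y else 0)" for n and y :: real
  have T_bound: "y \<ge> 0 \<Longrightarrow> \<bar>T n y\<bar> \<le> a ^ n" for n y using apos[of n] by (auto simp: T_def)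
  have [measurable]: "T n \<in> borel_measurable borel" for n unfolding T_def by measurable
  have [measurable]: "X0 \<in> borel_measurable M" using X0 by auto
  have Xm[measurable]: "X i \<in> borel_measurable M" if "i \<ge> 1" for i
    using indep that unfolding indep_vars_def by auto
  have transfer: "expectation (\<lambda>x. g (X i x)) = expectation (\<lambda>x. g (X0 x))"
    if "i \<ge> 1" "g \<in> borel_measurable borel" for g :: "real \<Rightarrow> real" and i
    using that dist by (intro expectation_eq_of_distr_eq) auto
  have intT2: "integrable M (\<lambda>x. (T n (X0 x))\<^sup>2)" for n
    using X0 power_mono[OF T_bound, of _ n 2]
    by (intro integrable_const_bound[where B = "(a ^ n)\<^sup>2"]) auto
  define c where "c n = expectation (\<lambda>x. T n (X0 x))" for n
  define W where "W n i x = T n (X i x) - c n" for n i x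
  \<comment> \<open>The variance of a sum of at most \<open>a ^ n\<close> summands truncated at \<open>a ^ n\<close>.\<close>
  have W_sq: "integrable M (\<lambda>x. (\<Sum>i=1..k n. W n i x)\<^sup>2)"
    "expectation (\<lambda>x. (\<Sum>i=1..k n. W n i x)\<^sup>2) \<le> a ^ n * expectation (\<lambda>x. (T n (X0 x))\<^sup>2)" for n
  proof -
    have T1: "integrable M (\<lambda>x. T n (X i x))" if "i \<in> {1..k n}" for i
      using nonneg that by (intro integrable_const_bound[where B = "a ^ n"]) (auto simp: T_bound)
    have T2: "integrable M (\<lambda>x. (T n (X i x))\<^sup>2)" if "i \<in> {1..k n}" for i
      using nonneg that power_mono[OF T_bound, of _ n 2]
      by (intro integrable_const_bound[where B = "(a ^ n)\<^sup>2"]) auto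
    have W2: "(W n i x)\<^sup>2 = (T n (X i x))\<^sup>2 - 2 * c n * T n (X i x) + (c n)\<^sup>2" for i x
      by (simp add: W_def power2_eq_square algebra_simps)
    have iW2: "integrable M (\<lambda>x. (W n i x)\<^sup>2)" if "i \<in> {1..k n}" for i
      unfolding W2 using T1[OF that] T2[OF that] by auto
    have EW: "expectation (W n i) = 0" if "i \<in> {1..k n}" for i
    proof -
      have "expectation (W n i) = expectation (\<lambda>x. T n (X i x)) - c n"
        unfolding W_def using T1[OF that] by (simp add: prob_space)
      then show ?thesis using transfer[of i "T n"] that by (simp add: c_def)
    qed
    have EW2: "expectation (\<lambda>x. (W n i x)\<^sup>2) \<le> expectation (\<lambda>x. (T n (X0 x))\<^sup>2)"
      if i: "i \<in> {1..k n}" for i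
    proof -
      have "expectation (\<lambda>x. (W n i x)\<^sup>2) =
          expectation (\<lambda>x. (T n (X i x))\<^sup>2) - 2 * c n * expectation (\<lambda>x. T n (X i x)) + (c n)\<^sup>2"
        unfolding W2 using T1[OF i] T2[OF i] by (simp add: prob_space)
      also have "\<dots> = expectation (\<lambda>x. (T n (X0 x))\<^sup>2) - (c n)\<^sup>2"
        using transfer[of i "T n"] transfer[of i "\<lambda>y. (T n y)\<^sup>2"] i
        by (simp add: c_def power2_eq_square)
      finally show ?thesis by simp
    qed
    have ind: "indep_vars (\<lambda>_. borel) (W n) {1..k n}"
      unfolding W_def
      by (rule indep_vars_compose2[OF indep_vars_subset[OF indep], of _ "\<lambda>i y. T n y - c n"]) auto
    have iW: "integrable M (W n i)" if "i \<in> {1..k n}" for i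
      unfolding W_def using T1[OF that] by auto
    note sq = expectation_square_sum_centered[OF finite_atLeastAtMost ind iW iW2 EW]
    show "integrable M (\<lambda>x. (\<Sum>i=1..k n. W n i x)\<^sup>2)" using sq by blast
    have "expectation (\<lambda>x. (\<Sum>i=1..k n. W n i x)\<^sup>2) = (\<Sum>i=1..k n. expectation (\<lambda>x. (W n i x)\<^sup>2))"
      using sq by blast
    also have "\<dots> \<le> real (card {1..k n}) * expectation (\<lambda>x. (T n (X0 x))\<^sup>2)"
      using EW2 by (intro sum_bounded_above) auto
    also have "\<dots> \<le> a ^ n * expectation (\<lambda>x. (T n (X0 x))\<^sup>2)"
      using k[of n] by (intro mult_right_mono) auto
    finally show "expectation (\<lambda>x. (\<Sum>i=1..k n. W n i x)\<^sup>2) \<le> a ^ n * expectation (\<lambda>x. (T n (X0 x))\<^sup>2)" .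
  qed
  define U where "U n x = (\<Sum>i=1..k n. W n i x)\<^sup>2 / (a ^ n)\<^sup>2" for n x
  have U_lim: "AE x in M. (\<lambda>n. U n x) \<longlonglongrightarrow> 0"
  proof (rule AE_tendsto_0_of_bounded_sum)
    show "integrable M (U n)" for n unfolding U_def using W_sq(1) by auto
    show "U n x \<ge> 0" for n x unfolding U_def by simp
    show "(\<Sum>n<N. expectation (U n)) \<le> ?C * expectation X0" for N
    proof -
      have EU: "expectation (U n) \<le> expectation (\<lambda>x. (T n (X0 x))\<^sup>2 / a ^ n)" for n
      proof -
        have "expectation (U n) \<le> (a ^ n * expectation (\<lambda>x. (T n (X0 x))\<^sup>2)) / (a ^ n)\<^sup>2"
          unfolding U_def using W_sq(2)[of n] by (simp add: divide_right_mono)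
        also have "\<dots> = expectation (\<lambda>x. (T n (X0 x))\<^sup>2 / a ^ n)"
          using apos[of n] by (simp add: power2_eq_square)
        finally show ?thesis .
      qed
      have "(\<Sum>n<N. expectation (U n)) \<le> (\<Sum>n<N. expectation (\<lambda>x. (T n (X0 x))\<^sup>2 / a ^ n))"
        by (intro sum_mono EU)
      also have "\<dots> = expectation (\<lambda>x. \<Sum>n<N. (T n (X0 x))\<^sup>2 / a ^ n)"
        using intT2 by (intro Bochner_Integration.integral_sum[symmetric]) auto
      also have "\<dots> \<le> expectation (\<lambda>x. ?C * X0 x)"
      proof (rule integral_mono)
        fix x
        have "(\<Sum>n<N. (T n (X0 x))\<^sup>2 / a ^ n) = (\<Sum>n<N. if X0 x \<le> a ^ n then (X0 x)\<^sup>2 / a ^ n else 0)"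
          by (intro sum.cong) (auto simp: T_def)
        also have "\<dots> \<le> ?C * X0 x" using geometric_sum_above[OF a X0(2)] .
        finally show "(\<Sum>n<N. (T n (X0 x))\<^sup>2 / a ^ n) \<le> ?C * X0 x" .
      qed (use intT2 X0 in auto)
      finally show ?thesis by simp
    qed
  qed
  \<comment> \<open>Outside \<open>A n\<close> the truncation does not alter any summand of the \<open>n\<close>-th sum.\<close>
  define A where "A n = (\<Union>i\<in>{1..k n}. {x \<in> space M. X i x > a ^ n})" for n
  have A_sets: "A n \<in> sets M" for n
    unfolding A_def by (intro sets.finite_UN) auto
  have A_ev: "AE x in M. eventually (\<lambda>n. x \<in> space M - A n) sequentially"
  proof (rule borel_cantelli_AE1)
    have meas: "measure M (A n) \<le> expectation (\<lambda>x. if a ^ n < X0 x then a ^ n else 0)" for n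
    proof -
      have "measure M (A n) \<le> (\<Sum>i=1..k n. measure M {x \<in> space M. X i x > a ^ n})"
        unfolding A_def by (intro finite_measure_subadditive_finite) auto
      also have "\<dots> = (\<Sum>i=1..k n. expectation (\<lambda>x. if a ^ n < X0 x then 1 else 0))"
      proof (intro sum.cong refl)
        fix i assume i: "i \<in> {1..k n}"
        then have [measurable]: "X i \<in> borel_measurable M" by (intro Xm) auto
        have "measure M {x \<in> space M. X i x > a ^ n} = expectation (indicator {x \<in> space M. X i x > a ^ n})"
          by simp
        also have "\<dots> = expectation (\<lambda>x. if a ^ n < X i x then 1 else 0)"
          by (intro Bochner_Integration.integral_cong) (auto simp: indicator_def)
        also have "\<dots> = expectation (\<lambda>x. if a ^ n < X0 x then 1 else 0)"
          using transfer[of i "\<lambda>y. if a ^ n < y then 1 else 0"] i by simp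
        finally show "measure M {x \<in> space M. X i x > a ^ n} = expectation (\<lambda>x. if a ^ n < X0 x then 1 else 0)" .
      qed
      also have "\<dots> = real (k n) * expectation (\<lambda>x. if a ^ n < X0 x then 1 else 0)" by simp
      also have "\<dots> \<le> a ^ n * expectation (\<lambda>x. if a ^ n < X0 x then 1 else 0)"
        using k[of n] by (intro mult_right_mono) (auto intro!: Bochner_Integration.integral_nonneg)
      also have "\<dots> = expectation (\<lambda>x. a ^ n * (if a ^ n < X0 x then 1 else 0))"
        by (rule Bochner_Integration.integral_mult_right_zero[symmetric])
      also have "\<dots> = expectation (\<lambda>x. if a ^ n < X0 x then a ^ n else 0)"
        by (intro Bochner_Integration.integral_cong) auto
      finally show ?thesis .
    qed
    have int: "integrable M (\<lambda>x. if a ^ n < X0 x then a ^ n else 0)" for n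
      using apos[of n] by (intro integrable_const_bound[where B = "a ^ n"]) auto
    have "(\<Sum>n<N. measure M (A n)) \<le> ?C * expectation X0" for N
    proof -
      have "(\<Sum>n<N. measure M (A n)) \<le> (\<Sum>n<N. expectation (\<lambda>x. if a ^ n < X0 x then a ^ n else 0))"
        by (intro sum_mono meas)
      also have "\<dots> = expectation (\<lambda>x. \<Sum>n<N. if a ^ n < X0 x then a ^ n else 0)"
        using int by (intro Bochner_Integration.integral_sum[symmetric]) auto
      also have "\<dots> \<le> expectation (\<lambda>x. ?C * X0 x)"
        using geometric_sum_below[OF a X0(2)] int X0 by (intro integral_mono) auto
      finally show ?thesis by simp
    qed
    then show "summable (\<lambda>n. measure M (A n))"
      by (intro summableI_nonneg_bounded[where x = "?C * expectation X0"]) auto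
  qed (use A_sets in \<open>auto simp: less_top[symmetric]\<close>)
  have c_lim: "c \<longlonglongrightarrow> expectation X0"
    unfolding c_def
  proof (rule integral_dominated_convergence[where w = X0])
    show "AE x in M. (\<lambda>n. T n (X0 x)) \<longlonglongrightarrow> X0 x"
    proof (rule AE_I2)
      fix x
      obtain N where "X0 x < a ^ N" using real_arch_pow[OF a] by blast
      then have "T n (X0 x) = X0 x" if "n \<ge> N" for n
        using power_increasing[OF that less_imp_le[OF a]] by (auto simp: T_def)
      then show "(\<lambda>n. T n (X0 x)) \<longlonglongrightarrow> X0 x"
        by (intro tendsto_eventually) (auto simp: eventually_sequentially)
    qed
  qed (use X0 in \<open>auto simp: T_def\<close>)
  have k_lim: "(\<lambda>n. k n / a ^ n) \<longlonglongrightarrow> 1"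
  proof (rule tendsto_sandwich[where f = "\<lambda>n. 1 - (1 / a) ^ n" and h = "\<lambda>_. 1"])
    have "1 - (1 / a) ^ n \<le> k n / a ^ n" for n
    proof -
      have "a ^ n - 1 \<le> k n" unfolding k_def by linarith
      then have "(a ^ n - 1) / a ^ n \<le> k n / a ^ n" using apos[of n] by (intro divide_right_mono) auto
      then show ?thesis using a by (simp add: diff_divide_distrib power_divide)
    qed
    then show "eventually (\<lambda>n. 1 - (1 / a) ^ n \<le> k n / a ^ n) sequentially" by simp
    have "(\<lambda>n. 1 - (1 / a) ^ n) \<longlonglongrightarrow> 1 - 0"
      using a by (intro tendsto_intros LIMSEQ_power_zero) auto
    then show "(\<lambda>n. 1 - (1 / a) ^ n) \<longlonglongrightarrow> 1" by simp
  qed (use k apos in auto)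
  show ?thesis
    using U_lim A_ev
  proof eventually_elim
    case (elim x)
    have "(\<lambda>n. sqrt (U n x)) \<longlonglongrightarrow> sqrt 0" by (intro tendsto_intros elim)
    moreover have "sqrt (U n x) = \<bar>(\<Sum>i=1..k n. W n i x) / a ^ n\<bar>" for n
      using a by (simp add: U_def real_sqrt_divide)
    ultimately have "(\<lambda>n. \<bar>(\<Sum>i=1..k n. W n i x) / a ^ n\<bar>) \<longlonglongrightarrow> 0" by simp
    then have W0: "(\<lambda>n. (\<Sum>i=1..k n. W n i x) / a ^ n) \<longlonglongrightarrow> 0" by (rule tendsto_rabs_zero_cancel)
    have "(\<lambda>n. (\<Sum>i=1..k n. W n i x) / a ^ n + k n / a ^ n * c n) \<longlonglongrightarrow> 0 + 1 * expectation X0"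
      by (intro tendsto_intros W0 k_lim c_lim)
    moreover have "eventually (\<lambda>n. (\<Sum>i=1..k n. W n i x) / a ^ n + k n / a ^ n * c n =
        (\<Sum>i=1..k n. X i x) / a ^ n) sequentially"
      using elim(2)
    proof eventually_elim
      case (elim n)
      have "(\<Sum>i=1..k n. W n i x) = (\<Sum>i=1..k n. X i x - c n)"
        using elim by (intro sum.cong) (auto simp: A_def W_def T_def not_less)
      also have "\<dots> = (\<Sum>i=1..k n. X i x) - k n * c n" by (simp add: sum_subtractf)
      finally show ?case by (simp add: diff_divide_distrib)
    qed
    ultimately have "(\<lambda>n. (\<Sum>i=1..k n. X i x) / a ^ n) \<longlonglongrightarrow> 0 + 1 * expectation X0"
      by (rule Lim_transform_eventually)
    then show ?case by (simp add: k_def)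
  qed
qed

text \<open>Nonnegativity makes the partial sums monotone, as interpolation between the geometric
  subsequences requires.\<close>

lemma slln_nonneg:
  fixes X :: "nat \<Rightarrow> 'a \<Rightarrow> real"
  assumes indep: "indep_vars (\<lambda>_. borel) X {1..}"
    and X0: "integrable M X0" "\<And>x. X0 x \<ge> 0"
    and nonneg: "\<And>i x. X i x \<ge> 0"
    and dist: "\<And>i. i \<ge> 1 \<Longrightarrow> distr M borel (X i) = distr M borel X0"
  shows "AE x in M. (\<lambda>n. (\<Sum>i=1..n. X i x) / real n) \<longlonglongrightarrow> expectation X0"
proof -
  have "AE x in M. \<forall>j::nat. (\<lambda>m. (\<Sum>i=1..nat \<lfloor>(1 + 1 / real (Suc j)) ^ m\<rfloor>. X i x) / (1 + 1 / real (Suc j)) ^ m)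
      \<longlonglongrightarrow> expectation X0"
    unfolding AE_all_countable
    by (intro allI slln_geometric_subsequence assms) auto
  then show ?thesis
  proof eventually_elim
    case (elim x)
    show ?case
      using elim nonneg
      by (intro tendsto_mean_of_geometric_subsequences)
        (auto intro!: sum_nonneg sum_mono2 simp: mono_def)
  qed
qed

text \<open>The positive and the negative parts are again independent and identically distributed.\<close>

theorem strong_law_of_large_numbers:
  fixes X :: "nat \<Rightarrow> 'a \<Rightarrow> real"
  assumes indep: "indep_vars (\<lambda>_. borel) X {1..}"
    and X0: "integrable M X0"
    and dist: "\<And>i. i \<ge> 1 \<Longrightarrow> distr M borel (X i) = distr M borel X0"
  shows "AE x in M. (\<lambda>n. (\<Sum>i=1..n. X i x) / real n) \<longlonglongrightarrow> expectation X0"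
proof -
  have [measurable]: "X0 \<in> borel_measurable M" using X0 by auto
  have Xm[measurable]: "X i \<in> borel_measurable M" if "i \<ge> 1" for i
    using indep that unfolding indep_vars_def by auto
  have part: "AE x in M. (\<lambda>n. (\<Sum>i=1..n. g (X i x)) / real n) \<longlonglongrightarrow> expectation (\<lambda>x. g (X0 x))"
    if [measurable]: "g \<in> borel_measurable borel" and g: "\<And>y. g y \<ge> 0" "\<And>y. g y \<le> \<bar>y\<bar>" for g :: "real \<Rightarrow> real"
  proof (rule slln_nonneg)
    show "indep_vars (\<lambda>_. borel) (\<lambda>i x. g (X i x)) {1..}"
      by (rule indep_vars_compose2[OF indep]) auto
    show "integrable M (\<lambda>x. g (X0 x))"
      using g by (intro Bochner_Integration.integrable_bound[OF X0]) auto
    show "distr M borel (\<lambda>x. g (X i x)) = distr M borel (\<lambda>x. g (X0 x))" if "i \<ge> 1" for i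
      using that by (intro distr_compose_eq[OF _ _ dist]) auto
  qed (use g in auto)
  have "AE x in M. (\<lambda>n. (\<Sum>i=1..n. max 0 (X i x)) / real n) \<longlonglongrightarrow> expectation (\<lambda>x. max 0 (X0 x))"
    by (rule part) auto
  moreover have "AE x in M. (\<lambda>n. (\<Sum>i=1..n. max 0 (- X i x)) / real n) \<longlonglongrightarrow> expectation (\<lambda>x. max 0 (- X0 x))"
    by (rule part) auto
  ultimately show ?thesis
  proof eventually_elim
    case (elim x)
    have "expectation X0 = expectation (\<lambda>x. max 0 (X0 x) - max 0 (- X0 x))"
      by (intro Bochner_Integration.integral_cong) auto
    also have "\<dots> = expectation (\<lambda>x. max 0 (X0 x)) - expectation (\<lambda>x. max 0 (- X0 x))"
      using X0 by (intro Bochner_Integration.integral_diff integrable_max) auto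
    finally have E: "expectation X0 = expectation (\<lambda>x. max 0 (X0 x)) - expectation (\<lambda>x. max 0 (- X0 x))" .
    have "(\<Sum>i=1..n. max 0 (X i x)) / real n - (\<Sum>i=1..n. max 0 (- X i x)) / real n = (\<Sum>i=1..n. X i x) / real n" for n
    proof -
      have "(\<Sum>i=1..n. max 0 (X i x)) - (\<Sum>i=1..n. max 0 (- X i x)) = (\<Sum>i=1..n. X i x)"
        unfolding sum_subtractf[symmetric] by (intro sum.cong) auto
      then show ?thesis by (simp add: diff_divide_distrib[symmetric])
    qed
    then show ?case using tendsto_diff[OF elim] unfolding E by simp
  qed
qed

lemma strong_law_of_large_numbers_compose:
  fixes Y :: "'a \<Rightarrow> 'b::topological_space" and g :: "'b \<Rightarrow> real"
  assumes indep: "indep_vars (\<lambda>_. borel) Ys {1..}"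
    and Y[measurable]: "Y \<in> borel_measurable M"
    and dist: "\<And>i. i \<ge> 1 \<Longrightarrow> distr M borel (Ys i) = distr M borel Y"
    and g[measurable]: "g \<in> borel_measurable borel" and int: "integrable M (\<lambda>\<omega>. g (Y \<omega>))"
  shows "AE \<omega> in M. (\<lambda>n. (\<Sum>i=1..n. g (Ys i \<omega>)) / real n) \<longlonglongrightarrow> expectation (\<lambda>\<omega>. g (Y \<omega>))"
proof (rule strong_law_of_large_numbers[OF _ int])
  show "indep_vars (\<lambda>_. borel) (\<lambda>i \<omega>. g (Ys i \<omega>)) {1..}"
    by (rule indep_vars_compose2[OF indep]) auto
  fix i :: nat assume i: "i \<ge> 1"
  have [measurable]: "Ys i \<in> borel_measurable M"
    using indep i unfolding indep_vars_def by auto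
  show "distr M borel (\<lambda>\<omega>. g (Ys i \<omega>)) = distr M borel (\<lambda>\<omega>. g (Y \<omega>))"
    by (rule distr_compose_eq[OF _ Y dist[OF i] g]) measurable
qed

end

section \<open>Inequalities for powers of the distance\<close>

text \<open>The mean value theorem; the derivative \<open>\<alpha> z\<^sup>\<alpha>\<^sup>-\<^sup>1\<close> increases with \<open>z\<close>. It is applied away from
  0 only, where real powers are differentiable.\<close>

lemma powr_diff_bound:
  fixes a b \<alpha> :: real
  assumes "\<alpha> > 1" "a \<ge> 0" "b \<ge> 0" "a \<le> m" "b \<le> m"
  shows "\<bar>a powr \<alpha> - b powr \<alpha>\<bar> \<le> \<alpha> * \<bar>a - b\<bar> * m powr (\<alpha> - 1)"
proof -
  have *: "y powr \<alpha> - x powr \<alpha> \<le> \<alpha> * (y - x) * m powr (\<alpha> - 1)"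
    if xy: "0 \<le> x" "x \<le> y" "y \<le> m" for x y
  proof (cases "x = 0 \<or> x = y")
    case True
    have "y powr \<alpha> = y * y powr (\<alpha> - 1)"
      using xy by (cases "y = 0") (auto simp: powr_mult_base)
    also have "\<dots> \<le> y * m powr (\<alpha> - 1)"
      using xy assms by (intro mult_left_mono powr_mono2) auto
    also have "\<dots> \<le> \<alpha> * (y * m powr (\<alpha> - 1))"
      using mult_right_mono[of 1 \<alpha> "y * m powr (\<alpha> - 1)"] xy assms by auto
    finally show ?thesis using True by (auto simp: mult.assoc)
  next
    case False
    then have "0 < x" "x < y" using xy by auto
    then have "\<exists>z. x < z \<and> z < y \<and> y powr \<alpha> - x powr \<alpha> = (y - x) * (\<alpha> * z powr (\<alpha> - 1))"
      by (intro MVT2) (auto intro!: derivative_eq_intros simp: powr_diff)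
    then obtain z where z: "x < z" "z < y" "y powr \<alpha> - x powr \<alpha> = (y - x) * (\<alpha> * z powr (\<alpha> - 1))"
      by blast
    have "z powr (\<alpha> - 1) \<le> m powr (\<alpha> - 1)" using z xy assms by (intro powr_mono2) auto
    then have "(y - x) * (\<alpha> * z powr (\<alpha> - 1)) \<le> (y - x) * (\<alpha> * m powr (\<alpha> - 1))"
      using xy assms by (intro mult_left_mono) auto
    then show ?thesis using z(3) by (simp add: algebra_simps)
  qed
  have mono: "x powr \<alpha> \<le> y powr \<alpha>" if "0 \<le> x" "x \<le> y" for x y :: real
    using that assms by (intro powr_mono2) auto
  show ?thesis
  proof (cases "a \<le> b")
    case True
    then show ?thesis using *[of a b] mono[of a b] assms by (simp add: abs_if)
  next
    case False
    then show ?thesis using *[of b a] mono[of b a] assms by (simp add: abs_if)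
  qed
qed

lemma powr_add_le:
  fixes a b \<beta> :: real
  assumes "\<beta> \<ge> 0" "a \<ge> 0" "b \<ge> 0"
  shows "(a + b) powr \<beta> \<le> 2 powr \<beta> * (a powr \<beta> + b powr \<beta>)"
proof -
  have "(a + b) powr \<beta> \<le> (2 * max a b) powr \<beta>" using assms by (intro powr_mono2) auto
  also have "\<dots> = 2 powr \<beta> * max a b powr \<beta>" using assms by (simp add: powr_mult)
  also have "\<dots> \<le> 2 powr \<beta> * (a powr \<beta> + b powr \<beta>)" by (intro mult_left_mono) (auto simp: max_def)
  finally show ?thesis .
qed

text \<open>Both the integrability of \<open>d(Y, q)\<^sup>\<alpha> - d(Y, p)\<^sup>\<alpha>\<close> under a moment of order \<open>\<alpha> - 1\<close> and the
  equicontinuity of the empirical objectives rest on this bound, whose dependence on \<open>y\<close> is of order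
  \<open>\<alpha> - 1\<close>.\<close>

lemma dist_powr_diff_bound:
  fixes y p q q0 :: "'q::metric_space"
  assumes "\<alpha> > 1" "dist p q0 \<le> R" "dist q q0 \<le> R"
  shows "\<bar>dist y q powr \<alpha> - dist y p powr \<alpha>\<bar> \<le>
    \<alpha> * dist p q * (2 powr (\<alpha> - 1) * (dist y q0 powr (\<alpha> - 1) + R powr (\<alpha> - 1)))"
proof -
  have R: "R \<ge> 0" using assms(2) zero_le_dist[of p q0] by linarith
  have le: "dist y q \<le> dist y q0 + R" "dist y p \<le> dist y q0 + R"
    using assms(2,3) dist_triangle2[of y q q0] dist_triangle2[of y p q0] by auto
  have "\<bar>dist y q - dist y p\<bar> \<le> dist p q" by metric
  then have "\<alpha> * \<bar>dist y q - dist y p\<bar> * (dist y q0 + R) powr (\<alpha> - 1) \<le>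
      \<alpha> * dist p q * (2 powr (\<alpha> - 1) * (dist y q0 powr (\<alpha> - 1) + R powr (\<alpha> - 1)))"
    using assms(1) R powr_add_le[of "\<alpha> - 1" "dist y q0" R] by (intro mult_mono) auto
  then show ?thesis
    using powr_diff_bound[OF assms(1) zero_le_dist zero_le_dist le] by linarith
qed

text \<open>To be read with \<open>r = d(q, q0)\<close>, \<open>t = d(y, q0)\<close> and \<open>s = d(y, q)\<close>. If \<open>t \<le> r / 3\<close> then
  \<open>s \<ge> 2 r / 3\<close> is at least twice \<open>t\<close> and the difference of the powers is of order \<open>r\<^sup>\<alpha>\<close>. If
  \<open>t > r / 3\<close> then \<open>r\<^sup>\<alpha>\<close> itself is at most a multiple of \<open>r t\<^sup>\<alpha>\<^sup>-\<^sup>1\<close>, and so is the possible loss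
  \<open>t\<^sup>\<alpha> - s\<^sup>\<alpha>\<close>; a large \<open>C\<close> absorbs both. The error term contains \<open>t\<close> to the power \<open>\<alpha> - 1\<close> only,
  so its empirical means stay bounded.\<close>

lemma powr_coercive:
  fixes \<alpha> :: real
  assumes "\<alpha> > 1"
  obtains c C where "c > 0" "C \<ge> 0"
    "\<And>r s t. r \<ge> 0 \<Longrightarrow> t \<ge> 0 \<Longrightarrow> s \<ge> \<bar>r - t\<bar> \<Longrightarrow>
       s powr \<alpha> - t powr \<alpha> \<ge> c * r powr \<alpha> - C * r * t powr (\<alpha> - 1)"
proof -
  define c where "c = (2 / 3) powr \<alpha> - (1 / 3 :: real) powr \<alpha>"
  define C where "C = \<alpha> + c * 3 powr (\<alpha> - 1)"
  have c: "c > 0" unfolding c_def using assms by (simp add: powr_less_mono2)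
  then have C: "C \<ge> 0" unfolding C_def using assms by simp
  have "s powr \<alpha> - t powr \<alpha> \<ge> c * r powr \<alpha> - C * r * t powr (\<alpha> - 1)"
    if r: "r \<ge> 0" and t: "t \<ge> 0" and s: "s \<ge> \<bar>r - t\<bar>" for r s t :: real
  proof (cases "t \<le> r / 3")
    case True
    have "s powr \<alpha> \<ge> (2 / 3 * r) powr \<alpha>" using True r s assms by (intro powr_mono2) auto
    moreover have "t powr \<alpha> \<le> (1 / 3 * r) powr \<alpha>" using True t assms by (intro powr_mono2) auto
    ultimately have "s powr \<alpha> - t powr \<alpha> \<ge> c * r powr \<alpha>"
      using r unfolding powr_mult c_def by (simp add: algebra_simps)
    moreover have "C * r * t powr (\<alpha> - 1) \<ge> 0" using C r by simp
    ultimately show ?thesis by linarith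
  next
    case False
    have split: "x powr \<alpha> = x * x powr (\<alpha> - 1)" if "x \<ge> 0" for x :: real
      using that by (cases "x = 0") (auto simp: powr_mult_base)
    have "c * r powr \<alpha> = c * r * r powr (\<alpha> - 1)" using split[OF r] by simp
    also have "\<dots> \<le> c * r * (3 * t) powr (\<alpha> - 1)"
      using False c r assms by (intro mult_left_mono powr_mono2) auto
    also have "\<dots> = c * 3 powr (\<alpha> - 1) * r * t powr (\<alpha> - 1)" using t by (simp add: powr_mult)
    finally have 1: "c * r powr \<alpha> - C * r * t powr (\<alpha> - 1) \<le> - (\<alpha> * r * t powr (\<alpha> - 1))"
      unfolding C_def by (simp add: algebra_simps)
    have 2: "- (\<alpha> * r * t powr (\<alpha> - 1)) \<le> s powr \<alpha> - t powr \<alpha>"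
    proof (cases "r \<le> t")
      case True
      have "\<bar>(t - r) powr \<alpha> - t powr \<alpha>\<bar> \<le> \<alpha> * \<bar>(t - r) - t\<bar> * t powr (\<alpha> - 1)"
        using True r t assms by (intro powr_diff_bound) auto
      moreover have "s powr \<alpha> \<ge> (t - r) powr \<alpha>" using True s assms by (intro powr_mono2) auto
      ultimately show ?thesis using r by auto
    next
      case False
      have "t powr \<alpha> = t * t powr (\<alpha> - 1)" by (rule split[OF t])
      also have "\<dots> \<le> (\<alpha> * r) * t powr (\<alpha> - 1)"
        using False r t assms mult_mono[of 1 \<alpha> t r] by (intro mult_right_mono) auto
      finally show ?thesis using powr_ge_zero[of s \<alpha>] by linarith
    qed
    show ?thesis using 1 2 by linarith
  qed
  then show thesis using that c C by blast
qed

section \<open>Approximate minimizers, outer limits and the one-sided Hausdorff distance\<close>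

lemma eps_argmin_setD:
  assumes "q \<in> eps_argmin_set e f" shows "f q \<le> e + f p"
proof -
  have "ereal (f q) \<le> ereal e + (INF x. ereal (f x))" using assms by (simp add: eps_argmin_set_def)
  also have "\<dots> \<le> ereal e + ereal (f p)" by (intro add_left_mono INF_lower) auto
  finally show ?thesis by simp
qed

lemma argmin_setI:
  assumes "\<And>p. f q \<le> f p" shows "q \<in> argmin_set f"
  using assms unfolding argmin_set_def by (auto intro!: antisym INF_greatest INF_lower)

lemma outer_limit_sequence:
  fixes B :: "nat \<Rightarrow> 'b::metric_space set"
  assumes "x \<in> outer_limit B"
  obtains n xs where "filterlim n at_top sequentially" "\<And>k. xs k \<in> B (n k)" "xs \<longlonglongrightarrow> x"
proof -
  have "\<exists>n z. n \<ge> Suc k \<and> z \<in> B n \<and> dist z x < 1 / real (Suc k)" for k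
  proof -
    have "x \<in> closure (\<Union>n\<in>{Suc k..}. B n)" using assms by (auto simp: outer_limit_def)
    then have "\<exists>z\<in>(\<Union>n\<in>{Suc k..}. B n). dist z x < 1 / real (Suc k)"
      unfolding closure_approachable by (elim allE[of _ "1 / real (Suc k)"]) auto
    then show ?thesis by auto
  qed
  then obtain n z where nz: "\<And>k. n k \<ge> Suc k" "\<And>k. z k \<in> B (n k)" "\<And>k. dist (z k) x < 1 / real (Suc k)"
    by metis
  have "filterlim n at_top sequentially"
    using nz(1) by (intro filterlim_at_top_mono[OF filterlim_Suc]) auto
  moreover have "z \<longlonglongrightarrow> x"
  proof (rule metric_LIMSEQ_I)
    fix r :: real assume "r > 0"
    then obtain m where m: "inverse (real (Suc m)) < r" using reals_Archimedean by blast
    show "\<exists>no. \<forall>n\<ge>no. dist (z n) x < r"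
    proof (intro exI allI impI)
      fix k assume "k \<ge> m"
      then have "1 / real (Suc k) \<le> inverse (real (Suc m))" by (simp add: field_simps)
      then show "dist (z k) x < r" using nz(3)[of k] m by linarith
    qed
  qed
  ultimately show thesis using that nz(2) by blast
qed

text \<open>Points of \<open>B n\<close> that stay away from \<open>M\<close> for infinitely many \<open>n\<close> would have a subsequential
  limit in the outer limit, hence in \<open>M\<close>. The argument covers \<open>M = {}\<close>: it then shows that
  \<open>B n\<close> is empty from some index on, since the distance is infinite otherwise.\<close>

lemma one_sided_hausdorff_dist_tendsto_0:
  fixes B :: "nat \<Rightarrow> 'q::metric_space set"
  assumes lim: "outer_limit B \<subseteq> M"
    and bdd: "bounded (\<Union>n\<in>{N1..}. B n)"
    and cpt: "\<And>C. C \<subseteq> (\<Union>n\<in>{N0..}. B n) \<Longrightarrow> closed C \<Longrightarrow> bounded C \<Longrightarrow> compact C"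
  shows "(\<lambda>n. one_sided_hausdorff_dist (B n) M) \<longlonglongrightarrow> 0"
proof (rule ccontr)
  assume "\<not> ?thesis"
  then obtain e where e: "e > 0" "\<not> eventually (\<lambda>n. one_sided_hausdorff_dist (B n) M < e) sequentially"
    by (auto simp: order_tendsto_iff)
  define N where "N = max N0 N1"
  \<comment> \<open>Only a strict lower bound of the supremum is exceeded by one of its members.\<close>
  obtain d where d: "0 < d" "d < e" using dense[OF e(1)] by blast
  have "\<exists>n x. n \<ge> m \<and> x \<in> B n \<and> (INF x'\<in>M. ennreal (dist x x')) > d" for m
  proof -
    obtain n where n: "n \<ge> m" "one_sided_hausdorff_dist (B n) M \<ge> e"
      using e(2) by (auto simp: eventually_sequentially not_less)
    then have "d < (SUP x\<in>B n. INF x'\<in>M. ennreal (dist x x'))"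
      using d unfolding one_sided_hausdorff_dist_def by (auto intro: less_le_trans)
    then show ?thesis using n by (auto simp: less_SUP_iff)
  qed
  then obtain n x where nx: "\<And>m. n m \<ge> m" "\<And>m. x m \<in> B (n m)"
    "\<And>m. (INF x'\<in>M. ennreal (dist (x m) x')) > d" by metis
  let ?y = "\<lambda>m. x (m + N)"
  have y_in: "?y m \<in> (\<Union>n\<in>{N..}. B n)" for m
    using nx(1)[of "m + N"] nx(2)[of "m + N"] by (auto intro!: bexI[of _ "n (m + N)"])
  have "\<exists>l r. strict_mono r \<and> (?y \<circ> r) \<longlonglongrightarrow> l"
  proof (rule ccontr)
    assume no: "\<not> ?thesis"
    \<comment> \<open>A limit point of the range would be the limit of a subsequence, so the range has none.\<close>
    have "closed (range ?y)"
      unfolding closed_limpt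
    proof (intro allI impI)
      fix l assume "l islimpt range ?y"
      then have "\<exists>r. strict_mono r \<and> (?y \<circ> r) \<longlonglongrightarrow> l"
        by (rule islimpt_range_imp_convergent_subsequence)
      then show "l \<in> range ?y" using no by blast
    qed
    moreover have "range ?y \<subseteq> (\<Union>n\<in>{N0..}. B n)" "range ?y \<subseteq> (\<Union>n\<in>{N1..}. B n)"
      using y_in by (fastforce simp: N_def)+
    ultimately have "compact (range ?y)" using cpt bounded_subset[OF bdd] by blast
    then show False using no by (metis compact_def rangeI)
  qed
  then obtain l r where r: "strict_mono r" "(?y \<circ> r) \<longlonglongrightarrow> l" by blast
  have "l \<in> closure (\<Union>k\<in>{j..}. B k)" for j
  proof -
    have "eventually (\<lambda>m. (?y \<circ> r) m \<in> (\<Union>k\<in>{j..}. B k)) sequentially"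
    proof (rule eventually_sequentiallyI[of j])
      fix m assume "m \<ge> j"
      then show "(?y \<circ> r) m \<in> (\<Union>k\<in>{j..}. B k)"
        using nx(1)[of "r m + N"] nx(2)[of "r m + N"] seq_suble[OF r(1), of m]
        by (auto intro!: bexI[of _ "n (r m + N)"])
    qed
    then have "eventually (\<lambda>m. (?y \<circ> r) m \<in> closure (\<Union>k\<in>{j..}. B k)) sequentially"
      by (rule eventually_mono) (rule subsetD[OF closure_subset])
    then show ?thesis
      by (rule Lim_in_closed_set[OF closed_closure]) (rule trivial_limit_sequentially, rule r(2))
  qed
  then have "l \<in> M" using lim by (auto simp: outer_limit_def)
  have far: "d < ennreal (dist ((?y \<circ> r) m) l)" for m
    using nx(3)[of "r m + N"] \<open>l \<in> M\<close> by (auto intro: less_le_trans INF_lower)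
  have "(\<lambda>m. ennreal (dist ((?y \<circ> r) m) l)) \<longlonglongrightarrow> ennreal 0"
    using r(2) tendsto_dist_iff by (intro tendsto_ennrealI) blast
  then have "eventually (\<lambda>m. ennreal (dist ((?y \<circ> r) m) l) < d) sequentially"
    using d by (auto dest: order_tendstoD)
  then obtain m where "ennreal (dist ((?y \<circ> r) m) l) < d"
    by (auto simp: eventually_sequentially)
  then show False using far[of m] by simp
qed

section \<open>The empirical objective along one fixed sample\<close>

context
  fixes \<alpha> :: real and q0 :: "'q::metric_space" and y :: "nat \<Rightarrow> 'q"
begin

definition empirical_objective :: "nat \<Rightarrow> 'q \<Rightarrow> real" where
  "empirical_objective n q = 1 / real n * (\<Sum>i=1..n. dist (y i) q powr \<alpha> - dist (y i) q0 powr \<alpha>)"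

definition empirical_moment :: "nat \<Rightarrow> real" where
  "empirical_moment n = (\<Sum>i=1..n. dist (y i) q0 powr (\<alpha> - 1)) / real n"

context
  assumes alpha: "\<alpha> > 1"
begin

lemma empirical_objective_diff_bound:
  assumes "dist p q0 \<le> R" "dist q q0 \<le> R"
  shows "\<bar>empirical_objective n q - empirical_objective n p\<bar> \<le>
    \<alpha> * 2 powr (\<alpha> - 1) * (empirical_moment n + R powr (\<alpha> - 1)) * dist p q"
proof (cases "n = 0")
  case True
  then show ?thesis using alpha by (simp add: empirical_objective_def empirical_moment_def)
next
  case False
  have "empirical_objective n q - empirical_objective n p = (\<Sum>i=1..n. dist (y i) q powr \<alpha> - dist (y i) p powr \<alpha>) / n"
    by (simp add: empirical_objective_def sum_subtractf diff_divide_distrib)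
  also have "\<bar>\<dots>\<bar> \<le> (\<Sum>i=1..n. \<bar>dist (y i) q powr \<alpha> - dist (y i) p powr \<alpha>\<bar>) / n"
    by (simp add: divide_right_mono)
  also have "\<dots> \<le> (\<Sum>i=1..n. \<alpha> * dist p q *
      (2 powr (\<alpha> - 1) * (dist (y i) q0 powr (\<alpha> - 1) + R powr (\<alpha> - 1)))) / n"
    by (intro divide_right_mono sum_mono dist_powr_diff_bound alpha assms) auto
  also have "\<dots> = \<alpha> * 2 powr (\<alpha> - 1) * (empirical_moment n + R powr (\<alpha> - 1)) * dist p q"
    using False
    by (simp add: empirical_moment_def sum_distrib_left[symmetric] sum.distrib field_simps)
  finally show ?thesis .
qed

text \<open>Comparison with \<open>p \<in> D\<close> near \<open>x\<close>: the distances \<open>|F\<^sub>n x\<^sub>n - F\<^sub>n p|\<close> are small by the uniform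
  Lipschitz bound on a ball around \<open>q0\<close>, \<open>|F\<^sub>n p - F p|\<close> by hypothesis, and \<open>|F p - F x|\<close> by
  continuity. A general index sequence is needed for points of the outer limit, which are limits
  along subsequences only.\<close>

lemma empirical_objective_continuous_convergence:
  assumes pointwise: "\<And>p. p \<in> D \<Longrightarrow> (\<lambda>n. empirical_objective n p) \<longlonglongrightarrow> F p"
    and dense: "\<And>x e. e > 0 \<Longrightarrow> \<exists>p\<in>D. dist p x < e"
    and moment: "empirical_moment \<longlonglongrightarrow> H"
    and cont: "isCont F x"
    and n: "filterlim n at_top sequentially" and x: "xs \<longlonglongrightarrow> x"
  shows "(\<lambda>k. empirical_objective (n k) (xs k)) \<longlonglongrightarrow> F x"
proof (rule tendstoI)
  fix e :: real assume e: "e > 0"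
  \<comment> \<open>All relevant points lie within distance \<open>R\<close> of \<open>q0\<close>, where \<open>K\<close> is an eventual Lipschitz constant.\<close>
  define R where "R = dist x q0 + 1"
  define K where "K = \<alpha> * 2 powr (\<alpha> - 1) * (\<bar>H\<bar> + 1 + R powr (\<alpha> - 1))"
  have K: "K \<ge> 0" using alpha by (simp add: K_def)
  obtain d where d: "d > 0" "\<And>p. dist p x < d \<Longrightarrow> \<bar>F p - F x\<bar> < e / 4"
    using cont e unfolding continuous_at_eps_delta dist_real_def
    by (metis divide_pos_pos zero_less_numeral)
  define r where "r = min 1 (min d (e / 4 / (K + 1)))"
  have r: "r > 0" "r \<le> 1" "r \<le> d" "(K + 1) * r \<le> e / 4"
  proof -
    have "0 < K + 1" "r \<le> e / 4 / (K + 1)" using K by (auto simp: r_def)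
    then show "(K + 1) * r \<le> e / 4" by (simp only: pos_le_divide_eq mult.commute)
  qed (use d e K in \<open>auto simp: r_def\<close>)
  obtain p where p: "p \<in> D" "dist p x < r" using dense[OF r(1)] by blast
  have "eventually (\<lambda>k. \<bar>empirical_objective (n k) p - F p\<bar> < e / 4) sequentially"
    using tendstoD[OF filterlim_compose[OF pointwise[OF p(1)] n], of "e / 4"] e
    by (simp add: dist_real_def)
  moreover have "eventually (\<lambda>k. empirical_moment (n k) < \<bar>H\<bar> + 1) sequentially"
    using order_tendstoD(2)[OF filterlim_compose[OF moment n], of "\<bar>H\<bar> + 1"] by auto
  moreover have "eventually (\<lambda>k. dist (xs k) x < r) sequentially"
    using tendstoD[OF x r(1)] .
  ultimately show "eventually (\<lambda>k. dist (empirical_objective (n k) (xs k)) (F x) < e) sequentially"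
  proof eventually_elim
    case (elim k)
    have "dist p q0 \<le> R" "dist (xs k) q0 \<le> R"
      using p elim(3) r(2) dist_triangle[of p q0 x] dist_triangle[of "xs k" q0 x] by (auto simp: R_def)
    then have "\<bar>empirical_objective (n k) (xs k) - empirical_objective (n k) p\<bar> \<le>
        \<alpha> * 2 powr (\<alpha> - 1) * (empirical_moment (n k) + R powr (\<alpha> - 1)) * dist p (xs k)"
      by (rule empirical_objective_diff_bound)
    also have "\<dots> \<le> K * dist p (xs k)"
      unfolding K_def using elim(2) alpha by (intro mult_right_mono mult_left_mono) auto
    also have "\<dots> \<le> (K + 1) * (2 * r)"
      using K p elim(3) dist_triangle2[of p "xs k" x] by (intro mult_mono) auto
    also have "\<dots> \<le> e / 2" using r(4) by simp
    finally have "\<bar>empirical_objective (n k) (xs k) - empirical_objective (n k) p\<bar> \<le> e / 2" .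
    moreover have "\<bar>F p - F x\<bar> < e / 4" using p r by (intro d) auto
    ultimately show ?case using elim(1) unfolding dist_real_def by linarith
  qed
qed

lemma outer_limit_eps_argmin_subset:
  assumes pointwise: "\<And>p. p \<in> D \<Longrightarrow> (\<lambda>n. empirical_objective n p) \<longlonglongrightarrow> F p"
    and dense: "\<And>x e. e > 0 \<Longrightarrow> \<exists>p\<in>D. dist p x < e"
    and moment: "empirical_moment \<longlonglongrightarrow> H"
    and cont: "\<And>x. isCont F x"
    and eps: "\<epsilon> \<longlonglongrightarrow> 0"
  shows "outer_limit (\<lambda>n. eps_argmin_set (\<epsilon> n) (empirical_objective n)) \<subseteq> argmin_set F"
proof
  fix x assume "x \<in> outer_limit (\<lambda>n. eps_argmin_set (\<epsilon> n) (empirical_objective n))"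
  then obtain n xs where nx: "filterlim n at_top sequentially"
      "\<And>k. xs k \<in> eps_argmin_set (\<epsilon> (n k)) (empirical_objective (n k))" "xs \<longlonglongrightarrow> x"
    by (rule outer_limit_sequence) blast
  note conv = empirical_objective_continuous_convergence[OF pointwise dense moment cont nx(1)]
  show "x \<in> argmin_set F"
  proof (rule argmin_setI)
    fix p
    have "(\<lambda>k. empirical_objective (n k) (xs k)) \<longlonglongrightarrow> F x"
      by (intro conv nx(3)) auto
    moreover have "(\<lambda>k. \<epsilon> (n k) + empirical_objective (n k) p) \<longlonglongrightarrow> 0 + F p"
      by (intro tendsto_add filterlim_compose[OF eps nx(1)] conv) auto
    ultimately have "F x \<le> 0 + F p"
      by (rule LIMSEQ_le) (use eps_argmin_setD[OF nx(2)] in auto)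
    then show "F x \<le> F p" by simp
  qed
qed

text \<open>Comparing with \<open>q0\<close>, where the empirical objective vanishes, an approximate minimizer at distance
  \<open>r > 1\<close> from \<open>q0\<close> satisfies, from some index on, \<open>c r\<^sup>\<alpha> \<le> 1 + C r (|H| + 1) \<le> L r\<close>
  with \<open>L = 1 + C (|H| + 1)\<close>. Since \<open>\<alpha> > 1\<close> this bounds \<open>r\<close>.\<close>

lemma eps_argmin_eventually_bounded:
  assumes moment: "empirical_moment \<longlonglongrightarrow> H" and eps: "\<epsilon> \<longlonglongrightarrow> 0"
  shows "\<exists>N. bounded (\<Union>n\<in>{N..}. eps_argmin_set (\<epsilon> n) (empirical_objective n))"
proof -
  obtain c C where c: "c > 0" "C \<ge> 0" and coercive:
    "\<And>r s t. r \<ge> 0 \<Longrightarrow> t \<ge> 0 \<Longrightarrow> s \<ge> \<bar>r - t\<bar> \<Longrightarrow>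
       s powr \<alpha> - t powr \<alpha> \<ge> c * r powr \<alpha> - C * r * t powr (\<alpha> - 1)"
    using powr_coercive[OF alpha] by blast
  have "eventually (\<lambda>n. empirical_moment n < \<bar>H\<bar> + 1 \<and> \<epsilon> n < 1) sequentially"
    using order_tendstoD(2)[OF moment, of "\<bar>H\<bar> + 1"] order_tendstoD(2)[OF eps, of 1]
    by (auto intro: eventually_conj)
  then obtain N0 where N0: "\<And>n. n \<ge> N0 \<Longrightarrow> empirical_moment n < \<bar>H\<bar> + 1 \<and> \<epsilon> n < 1"
    by (auto simp: eventually_sequentially)
  define L where "L = 1 + C * (\<bar>H\<bar> + 1)"
  define \<rho> where "\<rho> = max 1 ((L / c) powr (1 / (\<alpha> - 1)))"
  have "dist q0 q \<le> \<rho>" if n: "n \<ge> max 1 N0" and q: "q \<in> eps_argmin_set (\<epsilon> n) (empirical_objective n)" for n q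
  proof (cases "dist q0 q \<le> 1")
    case False
    define r where "r = dist q0 q"
    have r: "r > 1" using False by (simp add: r_def)
    have "c * r powr \<alpha> - C * r * empirical_moment n =
        1 / real n * (\<Sum>i=1..n. c * r powr \<alpha> - C * r * dist (y i) q0 powr (\<alpha> - 1))"
      using n by (simp add: empirical_moment_def sum_subtractf sum_distrib_left[symmetric] field_simps)
    also have "\<dots> \<le> empirical_objective n q"
      unfolding empirical_objective_def
    proof (intro mult_left_mono sum_mono coercive)
      show "\<bar>r - dist (y i) q0\<bar> \<le> dist (y i) q" for i unfolding r_def by metric
    qed (auto simp: r_def)
    also have "\<dots> \<le> \<epsilon> n + empirical_objective n q0" by (rule eps_argmin_setD[OF q])
    also have "\<dots> \<le> 1" using N0[of n] n by (simp add: empirical_objective_def)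
    finally have "c * r powr \<alpha> \<le> 1 + C * r * empirical_moment n" by simp
    also have "\<dots> \<le> r + C * r * (\<bar>H\<bar> + 1)"
      using N0[of n] n c r by (intro add_mono mult_left_mono) auto
    also have "\<dots> = r * L" by (simp add: L_def algebra_simps)
    finally have "r * (c * r powr (\<alpha> - 1)) \<le> r * L"
      using r powr_mult_base[of r "\<alpha> - 1"] by (simp add: mult_ac)
    then have "r powr (\<alpha> - 1) \<le> L / c" using r c by (simp add: field_simps)
    then have "(r powr (\<alpha> - 1)) powr (1 / (\<alpha> - 1)) \<le> (L / c) powr (1 / (\<alpha> - 1))"
      using alpha by (intro powr_mono2) auto
    then show ?thesis using alpha r by (simp add: powr_powr \<rho>_def r_def)
  qed (simp add: \<rho>_def)
  then have "\<forall>q\<in>(\<Union>n\<in>{max 1 N0..}. eps_argmin_set (\<epsilon> n) (empirical_objective n)). dist q0 q \<le> \<rho>"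
    by auto
  then show ?thesis unfolding bounded_def by blast
qed

end

end

section \<open>The expected objective\<close>

context prob_space
begin

lemma integrable_dist_powr_diff:
  fixes Y :: "'a \<Rightarrow> 'q::polish_space"
  assumes "\<alpha> > 1" "Y \<in> borel_measurable M"
    and h: "integrable M (\<lambda>\<omega>. dist (Y \<omega>) q0 powr (\<alpha> - 1))"
  shows "integrable M (\<lambda>\<omega>. dist (Y \<omega>) q powr \<alpha> - dist (Y \<omega>) p powr \<alpha>)"
proof (rule Bochner_Integration.integrable_bound)
  let ?R = "max (dist p q0) (dist q q0)"
  let ?b = "\<lambda>\<omega>. \<alpha> * dist p q * (2 powr (\<alpha> - 1) * (dist (Y \<omega>) q0 powr (\<alpha> - 1) + ?R powr (\<alpha> - 1)))"
  show "integrable M ?b" using h by auto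
  have [measurable]: "Y \<in> borel_measurable M" by fact
  show "(\<lambda>\<omega>. dist (Y \<omega>) q powr \<alpha> - dist (Y \<omega>) p powr \<alpha>) \<in> borel_measurable M"
    by measurable
  show "AE \<omega> in M. norm (dist (Y \<omega>) q powr \<alpha> - dist (Y \<omega>) p powr \<alpha>) \<le> norm (?b \<omega>)"
    using dist_powr_diff_bound[OF assms(1), of p q0 ?R q] by (auto intro: order_trans[OF _ abs_ge_self])
qed

lemma isCont_expected_dist_powr:
  fixes Y :: "'a \<Rightarrow> 'q::polish_space"
  assumes alpha: "\<alpha> > 1" and Y: "Y \<in> borel_measurable M"
    and h: "integrable M (\<lambda>\<omega>. dist (Y \<omega>) q0 powr (\<alpha> - 1))"
  shows "isCont (\<lambda>q. expectation (\<lambda>\<omega>. dist (Y \<omega>) q powr \<alpha> - dist (Y \<omega>) q0 powr \<alpha>)) x"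
proof -
  let ?F = "\<lambda>q. expectation (\<lambda>\<omega>. dist (Y \<omega>) q powr \<alpha> - dist (Y \<omega>) q0 powr \<alpha>)"
  define R where "R = dist x q0 + 1"
  define K where "K = expectation (\<lambda>\<omega>. \<alpha> * (2 powr (\<alpha> - 1) * (dist (Y \<omega>) q0 powr (\<alpha> - 1) + R powr (\<alpha> - 1))))"
  note int = integrable_dist_powr_diff[OF alpha Y h]
  have bound: "\<bar>?F q - ?F x\<bar> \<le> dist q x * K" if "dist q x < 1" for q
  proof -
    have R: "dist q q0 \<le> R" "dist x q0 \<le> R"
      using that dist_triangle[of q q0 x] by (auto simp: R_def)
    have "?F q - ?F x = expectation (\<lambda>\<omega>. dist (Y \<omega>) q powr \<alpha> - dist (Y \<omega>) x powr \<alpha>)"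
      using Bochner_Integration.integral_diff[OF int[of q q0] int[of x q0]] by simp
    also have "\<bar>\<dots>\<bar> \<le> expectation (\<lambda>\<omega>. \<bar>dist (Y \<omega>) q powr \<alpha> - dist (Y \<omega>) x powr \<alpha>\<bar>)"
      by (rule integral_abs_bound)
    also have "\<dots> \<le> expectation (\<lambda>\<omega>. dist q x *
        (\<alpha> * (2 powr (\<alpha> - 1) * (dist (Y \<omega>) q0 powr (\<alpha> - 1) + R powr (\<alpha> - 1)))))"
      using int[of q x] h dist_powr_diff_bound[OF alpha R(2,1)]
      by (intro integral_mono) (auto simp: dist_commute[of x q] mult_ac)
    also have "\<dots> = dist q x * K" by (simp add: K_def)
    finally show ?thesis .
  qed
  have "((\<lambda>q. ?F q - ?F x) \<longlongrightarrow> 0) (at x)"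
  proof (rule Lim_null_comparison)
    show "eventually (\<lambda>q. norm (?F q - ?F x) \<le> dist q x * K) (at x)"
      using bound by (auto simp: eventually_at intro!: exI[of _ 1])
    have "((\<lambda>q. dist q x * K) \<longlongrightarrow> dist x x * K) (at x)" by (intro tendsto_intros)
    then show "((\<lambda>q. dist q x * K) \<longlongrightarrow> 0) (at x)" by simp
  qed
  then show ?thesis unfolding isCont_def by (rule LIM_zero_cancel)
qed

end

section \<open>Strong consistency of empirical Frechet means\<close>

theorem corollary5p1:
  fixes \<alpha> :: real
    and q0 :: "'q :: polish_space"
    and P :: "'w measure"
    and Y :: "'w \<Rightarrow> 'q"
    and Ys :: "nat \<Rightarrow> 'w \<Rightarrow> 'q"
    and \<epsilon> :: "nat \<Rightarrow> real"
  defines "M \<equiv> frechet_mean_set \<alpha> P Y q0"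
    and "M' \<equiv> empirical_frechet_mean_set \<alpha> \<epsilon> Ys q0"
  assumes "\<alpha> > 1"
    and "prob_space P"
    and "Y \<in> borel_measurable P"
    and "prob_space.indep_vars P (\<lambda>_. borel) Ys {1..}"
    and "\<And>i. i \<ge> 1 \<Longrightarrow> distr P borel (Ys i) = distr P borel Y"
    and "\<And>n. n \<ge> 1 \<Longrightarrow> \<epsilon> n \<ge> 0"
    and "\<epsilon> \<longlonglongrightarrow> 0"
    and "integrable P (\<lambda>\<omega>. dist (Y \<omega>) q0 powr (\<alpha> - 1))"
  shows "(AE \<omega> in P. outer_limit (\<lambda>n. M' n \<omega>) \<subseteq> M) \<and>
    ((AE \<omega> in P. \<exists>N0\<ge>1. \<forall>B. B \<subseteq> (\<Union>n\<in>{N0..}. M' n \<omega>) \<and> closed B \<and> bounded B \<longrightarrow> compact B) \<longrightarrow>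
     (AE \<omega> in P. (\<lambda>n. one_sided_hausdorff_dist (M' n \<omega>) M) \<longlonglongrightarrow> 0))"
proof -
  interpret prob_space P by fact
  let ?f = "\<lambda>q y. dist y q powr \<alpha> - dist y q0 powr \<alpha>"
  let ?h = "\<lambda>y. dist y q0 powr (\<alpha> - 1)"
  let ?F = "\<lambda>q. expectation (\<lambda>\<omega>. ?f q (Y \<omega>))"
  note [measurable] = \<open>Y \<in> borel_measurable P\<close>
  note slln = strong_law_of_large_numbers_compose[OF assms(6,5,7)]
  obtain D :: "'q set" where D: "countable D" "\<And>U. open U \<Longrightarrow> U \<noteq> {} \<Longrightarrow> \<exists>p\<in>D. p \<in> U"
    using countable_dense_setE by blast
  have dense: "\<exists>p\<in>D. dist p x < e" if "e > 0" for x e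
    using D(2)[of "ball x e"] that by (auto simp: dist_commute)
  have "AE \<omega> in P. \<forall>p\<in>D. (\<lambda>n. (\<Sum>i=1..n. ?f p (Ys i \<omega>)) / real n) \<longlonglongrightarrow> ?F p"
    unfolding AE_ball_countable[OF D(1)]
    by (intro ballI slln integrable_dist_powr_diff[OF assms(3,5,10)]) measurable
  moreover have "AE \<omega> in P. (\<lambda>n. (\<Sum>i=1..n. ?h (Ys i \<omega>)) / real n) \<longlonglongrightarrow> expectation (\<lambda>\<omega>. ?h (Y \<omega>))"
    by (intro slln assms(10)) measurable
  ultimately have main: "AE \<omega> in P. outer_limit (\<lambda>n. M' n \<omega>) \<subseteq> M \<and> (\<exists>N. bounded (\<Union>n\<in>{N..}. M' n \<omega>))"
  proof eventually_elim
    case (elim \<omega>)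
    let ?y = "\<lambda>i. Ys i \<omega>"
    have M': "(\<lambda>n. M' n \<omega>) = (\<lambda>n. eps_argmin_set (\<epsilon> n) (empirical_objective \<alpha> q0 ?y n))"
      by (simp add: M'_def empirical_frechet_mean_set_def empirical_objective_def[abs_def])
    have M: "M = argmin_set ?F" by (simp add: M_def frechet_mean_set_def)
    have 1: "(\<lambda>n. empirical_objective \<alpha> q0 ?y n p) \<longlonglongrightarrow> ?F p" if "p \<in> D" for p
      using elim(1) that by (simp add: empirical_objective_def)
    have 2: "empirical_moment \<alpha> q0 ?y \<longlonglongrightarrow> expectation (\<lambda>\<omega>. ?h (Y \<omega>))"
      using elim(2) by (simp add: empirical_moment_def[abs_def])
    show ?case
      unfolding M' M
      using outer_limit_eps_argmin_subset[OF assms(3) 1 dense 2 isCont_expected_dist_powr[OF assms(3,5,10)] assms(9)]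
        eps_argmin_eventually_bounded[OF assms(3) 2 assms(9)] by blast
  qed
  show ?thesis
  proof (intro conjI impI)
    show "AE \<omega> in P. outer_limit (\<lambda>n. M' n \<omega>) \<subseteq> M" using main by auto
    assume "AE \<omega> in P. \<exists>N0\<ge>1. \<forall>B. B \<subseteq> (\<Union>n\<in>{N0..}. M' n \<omega>) \<and> closed B \<and> bounded B \<longrightarrow> compact B"
    then show "AE \<omega> in P. (\<lambda>n. one_sided_hausdorff_dist (M' n \<omega>) M) \<longlonglongrightarrow> 0"
      using main
    proof eventually_elim
      case (elim \<omega>)
      then obtain N0 N1 where
        compact: "\<And>B. B \<subseteq> (\<Union>n\<in>{N0..}. M' n \<omega>) \<Longrightarrow> closed B \<Longrightarrow> bounded B \<Longrightarrow> compact B"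
        and bounded: "bounded (\<Union>n\<in>{N1..}. M' n \<omega>)" and outer: "outer_limit (\<lambda>n. M' n \<omega>) \<subseteq> M"
        by metis
      show ?case by (rule one_sided_hausdorff_dist_tendsto_0[OF outer bounded compact])
    qed
  qed
qed

end
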